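(* (1) A connected Euclidean polyhedral surface is determined up to scaling by its discrete Laplacian operator: if $(S,T)$ is a closed connected triangulated surface with set of edges $E$ and $l,l':E\to\mathbb{R}_{>0}$ are two Euclidean polyhedral metrics on $(S,T)$ with the same discrete Laplacian operator, then $l'=\lambda l$ for some $\lambda>0$. (2) A spherical polyhedral surface is determined by its discrete Laplacian operator: if $(S,T)$ is a closed triangulated surface with set of edges $E$ and $l,l':E\to\mathbb{R}_{>0}$ are two spherical polyhedral metrics on $(S,T)$ with the same discrete Laplacian operator, then $l=l'$.
   Context: For a closed triangulated surface $(S,T)$ with set of edges $E$, a Euclidean (resp. spherical) polyhedral metric on $(S,T)$ is given by its edge length function $l:E\to\mathbb{R}_{>0}$ such that whenever $e_i,e_j,e_k$ are the three edges of a triangle of $T$, $l(e_i)+l(e_j)>l(e_k)$ (for all permutations), and, in the spherical case, additionally $l(e_i)+l(e_j)+l(e_k)<2\pi$. Each triangle of $T$ is then realized as the geodesic triangle in $\mathbb{E}^2$ (resp. in the unit sphere $\mathbb{S}^2$) with these edge lengths, and inner angles are those of these triangles. The discrete (cotangent) Laplacian operator of a polyhedral metric is identified with the function on edges $\phi_{-2}:E\to\mathbb{R}$, $\phi_{-2}(e)=-\cot(a)-\cot(a')$, where $a,a'$ are the two inner angles facing (opposite to) the edge $e$ in the two triangles containing $e$. Two metrics on $(S,T)$ have the same discrete Laplacian operator when these functions coincide on all of $E$. *)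

theory Defs
  imports "HOL-Analysis.Analysis"
begin

section \<open>Closed triangulated surfaces\<close>

text \<open>
  A closed triangulated surface is presented as a finite disjoint union of triangles whose
  sides are identified in pairs by homeomorphisms. The quotient space is always a closed
  surface. Several sides of one triangle may be identified with each other, and two triangles
  may share several edges or vertices; the triangulations that are simplicial complexes are
  among these gluings, as shown in the lemma \<open>simplicial_surface_as_gluing\<close> below.

  The corners of every triangle are indexed by the three-element type \<open>3\<close> (integers modulo 3).
  Side \<open>(t, i)\<close> is the side of the triangle \<open>t\<close> facing its corner \<open>i\<close>, with end points the
  corners \<open>i + 1\<close> and \<open>i + 2\<close>. It is identified with the side \<open>glue S (t, i) = (t', j)\<close>. If
  \<open>aligned S (t, i)\<close> holds, the identification takes the corners \<open>i + 1\<close>, \<open>i + 2\<close> of \<open>t\<close> to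
  the corners \<open>j + 1\<close>, \<open>j + 2\<close> of \<open>t'\<close> respectively, and otherwise to \<open>j + 2\<close>, \<open>j + 1\<close>.
  The component \<open>aligned\<close> is needed to determine the surface, but the metrics and their
  Laplacians only involve which sides are identified with each other.
\<close>

record 'f triangulated_surface =
  triangles :: "'f set"
  glue :: "'f \<times> 3 \<Rightarrow> 'f \<times> 3"
  aligned :: "'f \<times> 3 \<Rightarrow> bool"

definition sides :: "'f triangulated_surface \<Rightarrow> ('f \<times> 3) set" where
  "sides S = triangles S \<times> UNIV"

definition closed_triangulated_surface :: "'f triangulated_surface \<Rightarrow> bool" where
  "closed_triangulated_surface S \<longleftrightarrow>
     finite (triangles S) \<and>
     (\<forall>s\<in>sides S. glue S s \<in> sides S \<and> glue S s \<noteq> s \<and> glue S (glue S s) = s \<and>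
        aligned S (glue S s) = aligned S s)"

definition edge_at :: "'f triangulated_surface \<Rightarrow> 'f \<times> 3 \<Rightarrow> ('f \<times> 3) set" where
  "edge_at S s = {s, glue S s}"

definition edges :: "'f triangulated_surface \<Rightarrow> ('f \<times> 3) set set" where
  "edges S = edge_at S ` sides S"

text \<open>
  All identifications of points in the quotient are generated by those of sides, so the
  quotient is connected iff any two triangles are joined by a chain of triangles in which
  consecutive ones are glued along a side.
\<close>

definition adjacent :: "'f triangulated_surface \<Rightarrow> ('f \<times> 'f) set" where
  "adjacent S = {(t, t'). t \<in> triangles S \<and> (\<exists>i. t' = fst (glue S (t, i)))}"

definition connected_surface :: "'f triangulated_surface \<Rightarrow> bool" where
  "connected_surface S \<longleftrightarrow> (\<forall>t\<in>triangles S. \<forall>t'\<in>triangles S. (t, t') \<in> (adjacent S)\<^sup>*)"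


subsection \<open>Simplicial complexes as gluings\<close>

text \<open>
  Let \<open>K\<close> be the set of triangles of a simplicial complex triangulating a closed surface, each
  given by its three vertices, so that every edge is contained in exactly two triangles. Then
  \<open>K\<close> is presented by a gluing: the corner \<open>i\<close> of \<open>t\<close> is the vertex \<open>c t i\<close>, and
  sides are identified iff they have the same vertices.
\<close>

lemma simplicial_surface_as_gluing:
  fixes K :: "'v set set"
  assumes fin: "finite K"
    and card3: "\<And>t. t \<in> K \<Longrightarrow> card t = 3"
    and two: "\<And>t e. t \<in> K \<Longrightarrow> e \<subseteq> t \<Longrightarrow> card e = 2 \<Longrightarrow> card {t' \<in> K. e \<subseteq> t'} = 2"
  obtains S :: "'v set triangulated_surface" and c :: "'v set \<Rightarrow> 3 \<Rightarrow> 'v"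
  where "closed_triangulated_surface S" and "triangles S = K"
    and "\<And>t. t \<in> K \<Longrightarrow> bij_betw (c t) UNIV t"
    and "\<And>t i t' j. t \<in> K \<Longrightarrow> glue S (t, i) = (t', j) \<Longrightarrow>
           t' \<in> K \<and> t' \<noteq> t \<and> t' - {c t' j} = t - {c t i} \<and>
           (aligned S (t, i) \<longleftrightarrow> c t (i + 1) = c t' (j + 1))"
proof -
  have "\<exists>f :: 3 \<Rightarrow> 'v. bij_betw f UNIV t" if "t \<in> K" for t
    using card3[OF that] by (intro finite_same_card_bij) (auto intro: card_ge_0_finite)
  then obtain c :: "'v set \<Rightarrow> 3 \<Rightarrow> 'v" where c: "\<And>t. t \<in> K \<Longrightarrow> bij_betw (c t) UNIV t"
    by metis
  have c_in: "c t i \<in> t" if "t \<in> K" for t i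
    using c[OF that] by (auto simp: bij_betw_def)
  have c_inj: "i = j" if "t \<in> K" "c t i = c t j" for t i j
    using c[OF that(1)] that(2) by (auto simp: bij_betw_def inj_on_def)
  define P where "P s s' \<longleftrightarrow> fst s' \<in> K \<and> fst s' \<noteq> fst s \<and>
    fst s' - {c (fst s') (snd s')} = fst s - {c (fst s) (snd s)}" for s s' :: "'v set \<times> 3"
  have ex: "\<exists>s'. P s s'" and uniq: "P s s1 \<Longrightarrow> P s s2 \<Longrightarrow> s1 = s2"
    if s: "fst s \<in> K" for s s1 s2
  proof -
    define t where "t = fst s"
    define e where "e = t - {c t (snd s)}"
    have t: "t \<in> K" using s by (simp add: t_def)
    have fint: "finite x" if "x \<in> K" for x using card3[OF that] by (auto intro: card_ge_0_finite)
    have e: "e \<subseteq> t" "card e = 2" using card3[OF t] c_in[OF t] fint[OF t] by (auto simp: e_def)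
    obtain x y where xy: "{t' \<in> K. e \<subseteq> t'} = {x, y}" "x \<noteq> y"
      using two[OF t e] by (auto simp: card_2_iff)
    have "t \<in> {x, y}" using t e xy(1) by blast
    then obtain t' where t': "{t' \<in> K. e \<subseteq> t'} = {t, t'}" "t \<noteq> t'"
      using xy by blast
    have t'K: "t' \<in> K" and et': "e \<subseteq> t'" using t'(1) by auto
    have "card (t' - e) = 1"
      using card_Diff_subset[OF finite_subset[OF et' fint[OF t'K]] et'] card3[OF t'K] e(2) by simp
    then obtain v where v: "t' - e = {v}" by (auto simp: card_1_singleton_iff)
    then have "v \<in> range (c t')" using c[OF t'K] by (auto simp: bij_betw_def)
    then obtain j where j: "c t' j = v" by blast
    have "P s (t', j)" using t'(2) t'K v j et' by (auto simp: P_def t_def[symmetric] e_def[symmetric])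
    then show "\<exists>s'. P s s'" by blast
    have *: "r = (t', j)" if "P s r" for r
    proof -
      have r: "fst r \<in> K" "fst r \<noteq> t" "fst r - {c (fst r) (snd r)} = e"
        using that by (auto simp: P_def t_def e_def)
      then have "fst r = t'" using t'(1) by blast
      moreover have "c t' (snd r) = v" using r(3) v c_in[OF t'K, of "snd r"] calculation by blast
      ultimately show ?thesis using c_inj[OF t'K] j by (metis prod.collapse)
    qed
    show "P s s1 \<Longrightarrow> P s s2 \<Longrightarrow> s1 = s2" using *[of s1] *[of s2] by simp
  qed
  define g where "g s = (SOME s'. P s s')" for s
  have g: "P s (g s)" if "fst s \<in> K" for s
    using someI_ex[OF ex[OF that]] by (simp add: g_def)
  have gg: "g (g s) = s" if "fst s \<in> K" for s
  proof -
    have "fst (g s) \<in> K" and "P (g s) s" using g[OF that] that by (auto simp: P_def)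
    then show ?thesis using uniq g by blast
  qed
  define S where "S = \<lparr>triangles = K, glue = g,
    aligned = (\<lambda>s. c (fst s) (snd s + 1) = c (fst (g s)) (snd (g s) + 1))\<rparr>"
  show thesis
  proof (rule that[of S c])
    have "fst (g s) \<in> K \<and> g s \<noteq> s \<and> g (g s) = s" if "fst s \<in> K" for s
      using g[OF that] gg[OF that] unfolding P_def by metis
    then have "g s \<in> sides S \<and> g s \<noteq> s \<and> g (g s) = s" if "s \<in> sides S" for s
      using that by (auto simp: S_def sides_def mem_Times_iff)
    moreover have "triangles S = K" "glue S = g"
      and "aligned S s \<longleftrightarrow> c (fst s) (snd s + 1) = c (fst (g s)) (snd (g s) + 1)" for s
      by (simp_all add: S_def)
    ultimately show "closed_triangulated_surface S"
      unfolding closed_triangulated_surface_def using fin by metis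
    show "triangles S = K" by (simp add: S_def)
    show "bij_betw (c t) UNIV t" if "t \<in> K" for t using c[OF that] .
    show "t' \<in> K \<and> t' \<noteq> t \<and> t' - {c t' j} = t - {c t i} \<and>
           (aligned S (t, i) \<longleftrightarrow> c t (i + 1) = c t' (j + 1))"
      if "t \<in> K" "glue S (t, i) = (t', j)" for t i t' j
      using g[of "(t, i)"] that by (simp add: S_def P_def)
  qed
qed


section \<open>Inner angles of geodesic triangles\<close>

definition vec_angle :: "'a::real_inner \<Rightarrow> 'a \<Rightarrow> real" where
  "vec_angle u v = arccos (u \<bullet> v / (norm u * norm v))"

text \<open>The inner angle, facing the side of length \<open>a\<close>, of a triangle in the Euclidean plane with
  side lengths \<open>a\<close>, \<open>b\<close>, \<open>c\<close>.\<close>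

definition euclidean_angle :: "real \<Rightarrow> real \<Rightarrow> real \<Rightarrow> real" where
  "euclidean_angle a b c = (THE \<theta>. \<exists>A B C :: real ^ 2.
     dist B C = a \<and> dist C A = b \<and> dist A B = c \<and> \<theta> = vec_angle (B - A) (C - A))"

text \<open>The unit sphere in \<open>real ^ 3\<close> with its intrinsic distance. For \<open>Q \<noteq> \<plusminus>P\<close>, the vector
  \<open>sphere_direction P Q\<close> is tangent to the sphere at \<open>P\<close> and points along the minimal geodesic
  from \<open>P\<close> to \<open>Q\<close>. All sides of a spherical triangle considered here are shorter than \<open>pi\<close>
  (by the triangle inequalities and the perimeter bound), hence minimal geodesics.\<close>

definition sphere_dist :: "real ^ 3 \<Rightarrow> real ^ 3 \<Rightarrow> real" where
  "sphere_dist P Q = arccos (P \<bullet> Q)"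

definition sphere_direction :: "real ^ 3 \<Rightarrow> real ^ 3 \<Rightarrow> real ^ 3" where
  "sphere_direction P Q = Q - (P \<bullet> Q) *\<^sub>R P"

definition spherical_angle :: "real \<Rightarrow> real \<Rightarrow> real \<Rightarrow> real" where
  "spherical_angle a b c = (THE \<theta>. \<exists>A\<in>sphere 0 1. \<exists>B\<in>sphere 0 1. \<exists>C\<in>sphere 0 1.
     sphere_dist B C = a \<and> sphere_dist C A = b \<and> sphere_dist A B = c \<and>
     \<theta> = vec_angle (sphere_direction A B) (sphere_direction A C))"


section \<open>Polyhedral metrics and the discrete Laplacian\<close>

text \<open>A metric is a function on edges; its values outside \<open>edges S\<close> are irrelevant.\<close>

definition euclidean_polyhedral_metric ::
    "'f triangulated_surface \<Rightarrow> (('f \<times> 3) set \<Rightarrow> real) \<Rightarrow> bool" where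
  "euclidean_polyhedral_metric S l \<longleftrightarrow>
     (\<forall>e\<in>edges S. l e > 0) \<and>
     (\<forall>t\<in>triangles S. \<forall>i.
        l (edge_at S (t, i)) + l (edge_at S (t, i + 1)) > l (edge_at S (t, i + 2)))"

definition spherical_polyhedral_metric ::
    "'f triangulated_surface \<Rightarrow> (('f \<times> 3) set \<Rightarrow> real) \<Rightarrow> bool" where
  "spherical_polyhedral_metric S l \<longleftrightarrow>
     (\<forall>e\<in>edges S. l e > 0) \<and>
     (\<forall>t\<in>triangles S. \<forall>i.
        l (edge_at S (t, i)) + l (edge_at S (t, i + 1)) > l (edge_at S (t, i + 2))) \<and>
     (\<forall>t\<in>triangles S.
        l (edge_at S (t, 0)) + l (edge_at S (t, 1)) + l (edge_at S (t, 2)) < 2 * pi)"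

text \<open>In the following, \<open>ang\<close> is \<open>euclidean_angle\<close> or \<open>spherical_angle\<close>.\<close>

definition angle_facing ::
    "(real \<Rightarrow> real \<Rightarrow> real \<Rightarrow> real) \<Rightarrow> 'f triangulated_surface \<Rightarrow>
     (('f \<times> 3) set \<Rightarrow> real) \<Rightarrow> 'f \<times> 3 \<Rightarrow> real" where
  "angle_facing ang S l = (\<lambda>(t, i).
     ang (l (edge_at S (t, i))) (l (edge_at S (t, i + 1))) (l (edge_at S (t, i + 2))))"

text \<open>An edge is the set of the two sides glued to form it, so the sum has two terms.\<close>

definition discrete_laplacian ::
    "(real \<Rightarrow> real \<Rightarrow> real \<Rightarrow> real) \<Rightarrow> 'f triangulated_surface \<Rightarrow>
     (('f \<times> 3) set \<Rightarrow> real) \<Rightarrow> ('f \<times> 3) set \<Rightarrow> real" where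
  "discrete_laplacian ang S l e = (\<Sum>s\<in>e. - cot (angle_facing ang S l s))"

end

theory Submission imports Defs begin

text \<open>
  In both geometries the cotangents of the inner angles of a triangle are, up to sign, the gradient
  of a concave function of suitably transformed side lengths:

  \<^item> In the plane, Heron's formula makes four times the area the square root of a quadratic form
    in the squared side lengths \<open>u = l\<^sup>2\<close> (\<open>heron\<close>), and the gradient of this square root is
    the vector of cotangents (\<open>cot_euclidean_angle\<close>). The form has Lorentzian signature, so the
    reversed Cauchy-Schwarz inequality (\<open>heron_reversed_Cauchy_Schwarz\<close>) expresses concavity,
    which is strict except along rays.
  \<^item> On the sphere, put \<open>v = cos l\<close>. The function is the square root of the determinant of the
    Gram matrix of the three corners (\<open>gram\<close>), that is, the volume of the parallelepiped they
    span; its gradient is minus the vector of cotangents (\<open>cot_spherical_angle\<close>). On the convex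
    set of positive definite Gram matrices (\<open>elliptope_convex\<close>) its Hessian is negative definite
    (\<open>sqrt_gram_Hessian_neg\<close>), so its gradient is strictly monotone
    (\<open>sqrt_gram_gradient_strictly_monotone\<close>).

  For two metrics, concavity bounds from below, in each triangle, a sum of differences of
  cotangents weighted by a function of the edges: the weight is \<open>l'\<^sup>2\<close> in the plane and
  \<open>cos l - cos l'\<close> on the sphere. Summed over all triangles and rearranged by edges, these
  expressions pair the difference of the two Laplacians with the weight, which gives \<open>0\<close>
  (\<open>triangle_terms_zero_if_edgewise_balanced\<close>). So every triangle attains equality: it is
  unchanged on the sphere, and rescaled in the plane. In the plane neighbouring triangles share an
  edge and therefore the scaling factor, which is constant on a connected surface.
\<close>

section \<open>Summation over the edges of a surface\<close>

text \<open>Adding numerals to a corner index produces these numerals, which the simplifier does not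
  reduce modulo \<open>3\<close> when they are arguments.\<close>

lemma numerals_mod_3: "(3::3) = 0" "(4::3) = 1"
  by simp_all

lemma sum_corners: "(\<Sum>i\<in>(UNIV :: 3 set). f i) = f 0 + f 1 + f 2" for f :: "3 \<Rightarrow> real"
  using sum_3[of f] by (simp add: numerals_mod_3)

lemma all_corners: "(\<forall>i::3. P i) \<longleftrightarrow> P 0 \<and> P 1 \<and> P 2"
  using forall_3[of P] by (auto simp: numerals_mod_3)

text \<open>
  Each edge consists of exactly two sides, so the sum of all triangle terms can be rearranged into
  a sum over edges, in which \<open>y\<close> is a common factor on each edge and the sum of \<open>D\<close> cancels.
  Nonnegative terms with vanishing sum are all zero.
\<close>

lemma triangle_terms_zero_if_edgewise_balanced:
  fixes D :: "'f \<times> 3 \<Rightarrow> real" and y :: "('f \<times> 3) set \<Rightarrow> real"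
  assumes S: "closed_triangulated_surface S"
    and bal: "\<And>e. e \<in> edges S \<Longrightarrow> (\<Sum>s\<in>e. D s) = 0"
    and nonneg: "\<And>t. t \<in> triangles S \<Longrightarrow> (\<Sum>i\<in>UNIV. D (t, i) * y (edge_at S (t, i))) \<ge> 0"
    and t: "t \<in> triangles S"
  shows "(\<Sum>i\<in>UNIV. D (t, i) * y (edge_at S (t, i))) = 0"
proof -
  have fin: "finite (triangles S)" and fins: "finite (sides S)"
    using S by (auto simp: closed_triangulated_surface_def sides_def)
  have fibre: "{s \<in> sides S. edge_at S s = e} = e" if e: "e \<in> edges S" for e
  proof -
    obtain s where s: "s \<in> sides S" "e = {s, glue S s}"
      using e by (auto simp: edges_def edge_at_def)
    have g: "glue S s \<in> sides S" "glue S (glue S s) = s"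
      using S s(1) by (auto simp: closed_triangulated_surface_def)
    then have "edge_at S r = e \<longleftrightarrow> r \<in> e" if "r \<in> sides S" for r
      using S that unfolding s(2) edge_at_def closed_triangulated_surface_def by fastforce
    moreover have "e \<subseteq> sides S" using s g by auto
    ultimately show ?thesis by blast
  qed
  have "(\<Sum>t\<in>triangles S. \<Sum>i\<in>UNIV. D (t, i) * y (edge_at S (t, i)))
      = (\<Sum>s\<in>sides S. D s * y (edge_at S s))"
    by (simp add: sides_def sum.cartesian_product case_prod_unfold)
  also have "\<dots> = (\<Sum>e\<in>edges S. \<Sum>s\<in>{s \<in> sides S. edge_at S s = e}. D s * y (edge_at S s))"
    unfolding edges_def by (rule sum.image_gen[OF fins])
  also have "\<dots> = (\<Sum>e\<in>edges S. (\<Sum>s\<in>e. D s) * y e)"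
  proof (rule sum.cong[OF refl])
    fix e assume e: "e \<in> edges S"
    have "(\<Sum>s\<in>{s \<in> sides S. edge_at S s = e}. D s * y (edge_at S s))
        = (\<Sum>s\<in>{s \<in> sides S. edge_at S s = e}. D s * y e)"
      by (rule sum.cong) auto
    then show "(\<Sum>s\<in>{s \<in> sides S. edge_at S s = e}. D s * y (edge_at S s)) = (\<Sum>s\<in>e. D s) * y e"
      by (simp add: fibre[OF e] sum_distrib_right)
  qed
  also have "\<dots> = 0" using bal by simp
  finally show ?thesis
    using sum_nonneg_eq_0_iff[OF fin, of "\<lambda>t. \<Sum>i\<in>UNIV. D (t, i) * y (edge_at S (t, i))"] nonneg t
    by simp
qed

lemma same_laplacian_imp_balanced_cot:
  assumes "discrete_laplacian ang S l e = discrete_laplacian ang S l' e"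
  shows "(\<Sum>s\<in>e. cot (angle_facing ang S l s) - cot (angle_facing ang S l' s)) = 0"
  using assms by (simp add: discrete_laplacian_def sum_negf sum_subtractf)

lemma edge_at_in_edges: "t \<in> triangles S \<Longrightarrow> edge_at S (t, i) \<in> edges S"
  by (auto simp: edges_def sides_def)

lemma edges_E:
  assumes "e \<in> edges S"
  obtains t i where "t \<in> triangles S" "e = edge_at S (t, i)"
  using assms by (auto simp: edges_def sides_def)

section \<open>Cotangents of angles with given cosine\<close>

lemma cot_arccos:
  assumes "\<bar>x\<bar> < 1"
  shows "cot (arccos x) = x / sqrt (1 - x\<^sup>2)"
  using assms by (simp add: cot_def cos_arccos_abs sin_arccos_abs)

text \<open>Both laws of cosines give the cosine of an angle as a quotient \<open>x / p\<close>. In both cases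
  \<open>p\<^sup>2 - x\<^sup>2\<close> is symmetric in the three sides, so the cotangents of the three angles have the same
  denominator.\<close>

lemma cot_arccos_quotient:
  assumes "p > 0" "d > 0" "d = p\<^sup>2 - x\<^sup>2"
  shows "\<bar>x / p\<bar> < 1" "cot (arccos (x / p)) = x / sqrt d"
proof -
  have "x\<^sup>2 < p\<^sup>2" using assms by simp
  then have "\<bar>x\<bar> < p" using assms(1) power2_less_imp_less[of "\<bar>x\<bar>" p] by simp
  then show 1: "\<bar>x / p\<bar> < 1" using assms(1) by simp
  have "1 - (x / p)\<^sup>2 = d / p\<^sup>2" using assms by (simp add: field_simps)
  then have "sqrt (1 - (x / p)\<^sup>2) = sqrt d / p" using assms(1) by (simp add: real_sqrt_divide)
  then show "cot (arccos (x / p)) = x / sqrt d" using cot_arccos[OF 1] assms(1) by simp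
qed

section \<open>Euclidean triangles\<close>

text \<open>Sixteen times the squared area of a triangle, in terms of its squared side lengths.\<close>

definition heron :: "real \<Rightarrow> real \<Rightarrow> real \<Rightarrow> real" where
  "heron u v w = 2 * (u * v + v * w + w * u) - u\<^sup>2 - v\<^sup>2 - w\<^sup>2"

lemma heron_pos:
  assumes "a > 0" "b > 0" "c > 0" "a + b > c" "b + c > a" "c + a > b"
  shows "heron (a\<^sup>2) (b\<^sup>2) (c\<^sup>2) > 0"
proof -
  have "heron (a\<^sup>2) (b\<^sup>2) (c\<^sup>2) = (a + b + c) * (a + b - c) * (b + c - a) * (c + a - b)"
    unfolding heron_def by algebra
  then show ?thesis using assms by simp
qed

text \<open>The law of cosines determines the angle; an explicit triangle shows that the definition of
  the angle is not vacuous.\<close>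

lemma cot_euclidean_angle:
  assumes pos: "a > 0" "b > 0" "c > 0" and tri: "a + b > c" "b + c > a" "c + a > b"
  shows "cot (euclidean_angle a b c) = (b\<^sup>2 + c\<^sup>2 - a\<^sup>2) / sqrt (heron (a\<^sup>2) (b\<^sup>2) (c\<^sup>2))"
proof -
  define x where "x = (b\<^sup>2 + c\<^sup>2 - a\<^sup>2) / (2 * b * c)"
  have heron: "heron (a\<^sup>2) (b\<^sup>2) (c\<^sup>2) = (2 * b * c)\<^sup>2 - (b\<^sup>2 + c\<^sup>2 - a\<^sup>2)\<^sup>2"
    unfolding heron_def by algebra
  note q = cot_arccos_quotient[OF _ heron_pos[OF assms] heron]
  have x1: "\<bar>x\<bar> < 1" unfolding x_def using q(1) pos by simp
  have "euclidean_angle a b c = arccos x"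
    unfolding euclidean_angle_def
  proof (rule the_equality)
    define A B C :: "real ^ 2" where "A = 0" and "B = vector [c, 0]"
      and "C = vector [b * x, b * sqrt (1 - x\<^sup>2)]"
    have s: "(sqrt (1 - x\<^sup>2))\<^sup>2 = 1 - x\<^sup>2" using x1 by (simp add: abs_square_le_1 less_imp_le)
    have BB: "B \<bullet> B = c\<^sup>2" by (simp add: B_def inner_vec_def sum_2 power2_eq_square)
    have "C \<bullet> C = b\<^sup>2 * (x\<^sup>2 + (sqrt (1 - x\<^sup>2))\<^sup>2)"
      by (simp only: C_def inner_vec_def sum_2 vector_2 inner_real_def) algebra
    then have CC: "C \<bullet> C = b\<^sup>2" unfolding s by simp
    have BC: "B \<bullet> C = c * b * x" by (simp add: B_def C_def inner_vec_def sum_2)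
    have nB: "norm B = c" and nC: "norm C = b" using BB CC pos by (simp_all add: norm_eq_sqrt_inner)
    have "(norm (B - C))\<^sup>2 = c\<^sup>2 + b\<^sup>2 - 2 * (c * b * x)"
      using BB CC BC by (simp add: power2_norm_eq_inner inner_diff inner_commute)
    also have "c * b * x = (b\<^sup>2 + c\<^sup>2 - a\<^sup>2) / 2" using pos by (simp add: x_def)
    also have "c\<^sup>2 + b\<^sup>2 - 2 * ((b\<^sup>2 + c\<^sup>2 - a\<^sup>2) / 2) = a\<^sup>2" by argo
    finally have "dist B C = a" using pos by (simp add: dist_norm)
    moreover have "dist C A = b" "dist A B = c" using nB nC by (simp_all add: A_def)
    moreover have "arccos x = vec_angle (B - A) (C - A)"
      using nB nC BC pos by (simp add: vec_angle_def A_def)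
    ultimately show "\<exists>A B C :: real ^ 2. dist B C = a \<and> dist C A = b \<and> dist A B = c \<and>
        arccos x = vec_angle (B - A) (C - A)" by blast
  next
    fix \<theta> assume "\<exists>A B C :: real ^ 2. dist B C = a \<and> dist C A = b \<and> dist A B = c \<and>
        \<theta> = vec_angle (B - A) (C - A)"
    then obtain A B C :: "real ^ 2" where d: "dist B C = a" "dist C A = b" "dist A B = c"
      and \<theta>: "\<theta> = vec_angle (B - A) (C - A)" by blast
    have n: "norm (B - A) = c" "norm (C - A) = b" "norm ((B - A) - (C - A)) = a"
      using d by (simp_all add: dist_norm norm_minus_commute)
    have "(B - A) \<bullet> (C - A) = (b\<^sup>2 + c\<^sup>2 - a\<^sup>2) / 2"
      using dot_norm_neg[of "B - A" "C - A"] n by simp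
    then have "\<theta> = arccos ((b\<^sup>2 + c\<^sup>2 - a\<^sup>2) / 2 / (c * b))"
      by (simp only: \<theta> vec_angle_def n(1,2))
    also have "(b\<^sup>2 + c\<^sup>2 - a\<^sup>2) / 2 / (c * b) = x" by (simp add: x_def ac_simps)
    finally show "\<theta> = arccos x" .
  qed
  then show ?thesis unfolding x_def using q(2) pos by simp
qed

text \<open>
  The number \<open>P\<close> is the value at the two vectors of the symmetric bilinear form of \<open>heron\<close>. This
  form is negative semidefinite on vectors \<open>(0, d, e)\<close>, where it is \<open>- (d - e)\<^sup>2\<close>.
  Subtracting from the second vector the multiple \<open>r = u' / u\<close> of the first one removes the first
  entry; calling the other two entries of the difference \<open>d\<close> and \<open>e\<close> and expanding the form, what remains is the
  inequality between the arithmetic and geometric means of \<open>r\<^sup>2 * heron u v w\<close> and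
  \<open>heron u' v' w'\<close>.
\<close>

lemma heron_reversed_Cauchy_Schwarz:
  fixes u v w u' v' w' :: real
  assumes pos: "u > 0" "u' > 0" and Q: "heron u v w > 0" "heron u' v' w' > 0"
  defines "P \<equiv> (v + w - u) * u' + (w + u - v) * v' + (u + v - w) * w'"
  shows "P \<ge> sqrt (heron u v w) * sqrt (heron u' v' w')"
    and "P = sqrt (heron u v w) * sqrt (heron u' v' w') \<Longrightarrow> v' = u' / u * v \<and> w' = u' / u * w"
proof -
  define q q' where "q = sqrt (heron u v w)" and "q' = sqrt (heron u' v' w')"
  define r where "r = u' / u"
  define d e where "d = v' - r * v" and "e = w' - r * w"
  have r: "r > 0" and u': "u' = r * u" using pos by (simp_all add: r_def)
  have v': "v' = r * v + d" and w': "w' = r * w + e" by (simp_all add: d_def e_def)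
  have q2: "q\<^sup>2 = heron u v w" "q'\<^sup>2 = heron u' v' w'" using Q by (simp_all add: q_def q'_def)
  have "2 * r * P = r\<^sup>2 * heron u v w + heron u' v' w' + (d - e)\<^sup>2"
    unfolding P_def heron_def u' v' w' by algebra
  then have key: "2 * r * (P - q * q') = (r * q - q')\<^sup>2 + (d - e)\<^sup>2"
    unfolding q2[symmetric] by (simp add: power2_eq_square algebra_simps)
  then have "2 * r * (P - q * q') \<ge> 0" by simp
  then show "P \<ge> sqrt (heron u v w) * sqrt (heron u' v' w')"
    using r by (simp add: q_def[symmetric] q'_def[symmetric] zero_le_mult_iff)
  assume "P = sqrt (heron u v w) * sqrt (heron u' v' w')"
  then have "(r * q - q')\<^sup>2 + (d - e)\<^sup>2 = 0" using key by (simp add: q_def q'_def)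
  then have "r * q = q'" and de: "d = e" by (simp_all add: sum_power2_eq_zero_iff)
  \<comment> \<open>The remaining null vector \<open>(0, d, d)\<close> is excluded because adding it would change the value of the form.\<close>
  then have "r\<^sup>2 * heron u v w = heron u' v' w'" using q2 by (metis power_mult_distrib)
  moreover have "heron u' v' w' = r\<^sup>2 * heron u v w + 4 * r * u * d"
    unfolding heron_def u' v' w' de by algebra
  ultimately have "d = 0" using r pos by simp
  then show "v' = u' / u * v \<and> w' = u' / u * w" using v' w' de by (simp add: r_def)
qed

text \<open>By homogeneity, the cotangents of a triangle paired with its own squared side lengths give
  four times its area, so \<open>D \<ge> 0\<close> is the reversed Cauchy-Schwarz inequality divided by the
  square root of \<open>heron\<close> at the first triangle.\<close>

lemma euclidean_triangle_rigid:
  assumes pos: "a > 0" "b > 0" "c > 0" and tri: "a + b > c" "b + c > a" "c + a > b"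
    and pos': "a' > 0" "b' > 0" "c' > 0" and tri': "a' + b' > c'" "b' + c' > a'" "c' + a' > b'"
  defines "D \<equiv> (cot (euclidean_angle a b c) - cot (euclidean_angle a' b' c')) * a'\<^sup>2
    + (cot (euclidean_angle b c a) - cot (euclidean_angle b' c' a')) * b'\<^sup>2
    + (cot (euclidean_angle c a b) - cot (euclidean_angle c' a' b')) * c'\<^sup>2"
  shows "D \<ge> 0" and "D = 0 \<Longrightarrow> \<exists>k>0. a' = k * a \<and> b' = k * b \<and> c' = k * c"
proof -
  define h h' where "h = heron (a\<^sup>2) (b\<^sup>2) (c\<^sup>2)" and "h' = heron (a'\<^sup>2) (b'\<^sup>2) (c'\<^sup>2)"
  have h: "h > 0" and h': "h' > 0"
    unfolding h_def h'_def using pos tri pos' tri' by (auto intro: heron_pos)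
  have rot: "heron (b\<^sup>2) (c\<^sup>2) (a\<^sup>2) = h" "heron (c\<^sup>2) (a\<^sup>2) (b\<^sup>2) = h"
    "heron (b'\<^sup>2) (c'\<^sup>2) (a'\<^sup>2) = h'" "heron (c'\<^sup>2) (a'\<^sup>2) (b'\<^sup>2) = h'"
    by (simp_all add: h_def h'_def heron_def algebra_simps)
  have cots: "cot (euclidean_angle a b c) = (b\<^sup>2 + c\<^sup>2 - a\<^sup>2) / sqrt h"
    "cot (euclidean_angle b c a) = (c\<^sup>2 + a\<^sup>2 - b\<^sup>2) / sqrt h"
    "cot (euclidean_angle c a b) = (a\<^sup>2 + b\<^sup>2 - c\<^sup>2) / sqrt h"
    "cot (euclidean_angle a' b' c') = (b'\<^sup>2 + c'\<^sup>2 - a'\<^sup>2) / sqrt h'"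
    "cot (euclidean_angle b' c' a') = (c'\<^sup>2 + a'\<^sup>2 - b'\<^sup>2) / sqrt h'"
    "cot (euclidean_angle c' a' b') = (a'\<^sup>2 + b'\<^sup>2 - c'\<^sup>2) / sqrt h'"
    using cot_euclidean_angle pos tri pos' tri' rot h_def h'_def by simp_all
  define P where "P = (b\<^sup>2 + c\<^sup>2 - a\<^sup>2) * a'\<^sup>2 + (c\<^sup>2 + a\<^sup>2 - b\<^sup>2) * b'\<^sup>2 + (a\<^sup>2 + b\<^sup>2 - c\<^sup>2) * c'\<^sup>2"
  have "(b'\<^sup>2 + c'\<^sup>2 - a'\<^sup>2) * a'\<^sup>2 + (c'\<^sup>2 + a'\<^sup>2 - b'\<^sup>2) * b'\<^sup>2 + (a'\<^sup>2 + b'\<^sup>2 - c'\<^sup>2) * c'\<^sup>2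
      = sqrt h' * sqrt h'"
    using h' by (simp, simp add: h'_def heron_def algebra_simps power2_eq_square)
  then have "((b'\<^sup>2 + c'\<^sup>2 - a'\<^sup>2) * a'\<^sup>2 + (c'\<^sup>2 + a'\<^sup>2 - b'\<^sup>2) * b'\<^sup>2 + (a'\<^sup>2 + b'\<^sup>2 - c'\<^sup>2) * c'\<^sup>2)
      / sqrt h' = sqrt h'" using h' by (simp add: real_div_sqrt)
  moreover have sum_quotients: "(p1 / s - q1 / s') * u1 + (p2 / s - q2 / s') * u2 + (p3 / s - q3 / s') * u3
      = (p1 * u1 + p2 * u2 + p3 * u3) / s - (q1 * u1 + q2 * u2 + q3 * u3) / s'"
    for p1 p2 p3 q1 q2 q3 u1 u2 u3 s s' :: real
    by (simp add: left_diff_distrib add_divide_distrib)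
  ultimately have D: "D = P / sqrt h - sqrt h'"
    unfolding D_def cots P_def sum_quotients by simp
  note CS = heron_reversed_Cauchy_Schwarz[of "a\<^sup>2" "a'\<^sup>2" "b\<^sup>2" "c\<^sup>2" "b'\<^sup>2" "c'\<^sup>2",
      folded h_def h'_def P_def, OF _ _ h h']
  show "D \<ge> 0" using CS(1) pos pos' h by (simp add: D field_simps)
  assume "D = 0"
  then have "P = sqrt h * sqrt h'" using h by (simp add: D field_simps)
  then have "b'\<^sup>2 = a'\<^sup>2 / a\<^sup>2 * b\<^sup>2" "c'\<^sup>2 = a'\<^sup>2 / a\<^sup>2 * c\<^sup>2" using CS(2) pos pos' by simp_all
  then have "b'\<^sup>2 = (a' / a * b)\<^sup>2" "c'\<^sup>2 = (a' / a * c)\<^sup>2"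
    by (simp_all add: power_mult_distrib power_divide)
  then have "b' = a' / a * b" "c' = a' / a * c"
    using pos pos' by (simp_all add: power2_eq_iff_nonneg)
  then show "\<exists>k>0. a' = k * a \<and> b' = k * b \<and> c' = k * c"
    using pos pos' by (intro exI[of _ "a' / a"]) auto
qed

section \<open>Spherical triangles\<close>

text \<open>The determinant of the symmetric matrix with unit diagonal and off-diagonal entries
  \<open>x\<close>, \<open>y\<close>, \<open>z\<close>.\<close>

definition gram :: "real \<Rightarrow> real \<Rightarrow> real \<Rightarrow> real" where
  "gram x y z = 1 + 2 * x * y * z - x\<^sup>2 - y\<^sup>2 - z\<^sup>2"

definition elliptope :: "real \<Rightarrow> real \<Rightarrow> real \<Rightarrow> bool" where
  "elliptope x y z \<longleftrightarrow> x\<^sup>2 < 1 \<and> y\<^sup>2 < 1 \<and> z\<^sup>2 < 1 \<and> gram x y z > 0"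

text \<open>Sylvester's criterion. Both directions complete the squares in the quadratic form; for the
  converse the form is evaluated at the vector where the squares containing the first two
  variables vanish, leaving a multiple of the determinant.\<close>

lemma elliptope_iff_pos_def:
  "elliptope x y z \<longleftrightarrow> (\<forall>p q r. (p, q, r) \<noteq> (0, 0, 0) \<longrightarrow>
     p\<^sup>2 + q\<^sup>2 + r\<^sup>2 + 2 * z * p * q + 2 * y * p * r + 2 * x * q * r > 0)"
  (is "_ \<longleftrightarrow> (\<forall>p q r. _ \<longrightarrow> ?F p q r > 0)")
proof
  assume E: "elliptope x y z"
  show "\<forall>p q r. (p, q, r) \<noteq> (0, 0, 0) \<longrightarrow> ?F p q r > 0"
  proof (intro allI impI)
    fix p q r :: real assume nz: "(p, q, r) \<noteq> (0, 0, 0)"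
    have "(1 - z\<^sup>2) * ?F p q r = (1 - z\<^sup>2) * (p + z * q + y * r)\<^sup>2
        + ((1 - z\<^sup>2) * q + (x - y * z) * r)\<^sup>2 + gram x y z * r\<^sup>2"
      unfolding gram_def by algebra
    moreover have "\<dots> > 0"
    proof (cases "r = 0")
      case True
      then show ?thesis using E nz
        by (cases "q = 0") (auto simp: elliptope_def intro: add_nonneg_pos add_pos_nonneg)
    next
      case False
      then show ?thesis using E
        by (auto simp: elliptope_def intro!: add_nonneg_pos)
    qed
    ultimately have "(1 - z\<^sup>2) * ?F p q r > 0" by simp
    then show "?F p q r > 0" by (rule zero_less_mult_pos) (use E in \<open>simp add: elliptope_def\<close>)
  qed
next
  assume "\<forall>p q r. (p, q, r) \<noteq> (0, 0, 0) \<longrightarrow> ?F p q r > 0"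
  then have F: "?F p q r > 0" if "p \<noteq> 0 \<or> q \<noteq> 0 \<or> r \<noteq> 0" for p q r using that by auto
  have sq: "x\<^sup>2 < 1" "y\<^sup>2 < 1" "z\<^sup>2 < 1"
    using F[of 0 "- x" 1] F[of "- y" 0 1] F[of "- z" 1 0] by (simp_all add: power2_eq_square)
  define q r where "q = - (x - y * z)" and "r = 1 - z\<^sup>2"
  have "?F (- (z * q + y * r)) q r = (1 - z\<^sup>2) * gram x y z"
    unfolding q_def r_def gram_def by algebra
  moreover have "?F (- (z * q + y * r)) q r > 0" using F sq(3) by (simp add: r_def)
  ultimately show "elliptope x y z" using sq by (simp add: elliptope_def zero_less_mult_iff)
qed

text \<open>For a fixed vector the quadratic form is affine in the entries of the matrix, hence positive
  definiteness is preserved on segments.\<close>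

lemma elliptope_convex:
  assumes E: "elliptope x y z" and E': "elliptope (x + h) (y + k) (z + m)"
    and t: "0 \<le> t" "t \<le> 1"
  shows "elliptope (x + t * h) (y + t * k) (z + t * m)"
  unfolding elliptope_iff_pos_def
proof (intro allI impI)
  fix p q r :: real assume nz: "(p, q, r) \<noteq> (0, 0, 0)"
  define F where "F x y z = p\<^sup>2 + q\<^sup>2 + r\<^sup>2 + 2 * z * p * q + 2 * y * p * r + 2 * x * q * r" for x y z
  have "F x y z > 0" "F (x + h) (y + k) (z + m) > 0"
    using E E' nz unfolding elliptope_iff_pos_def F_def by blast+
  moreover have "F (x + t * h) (y + t * k) (z + t * m)
      = (1 - t) * F x y z + t * F (x + h) (y + k) (z + m)"
    unfolding F_def by algebra
  moreover have "(1 - t) * F x y z + t * F (x + h) (y + k) (z + m) > 0"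
    using calculation(1,2) t
    by (cases "t = 0") (auto intro!: add_nonneg_pos mult_nonneg_nonneg)
  ultimately show "p\<^sup>2 + q\<^sup>2 + r\<^sup>2 + 2 * (z + t * m) * p * q + 2 * (y + t * k) * p * r
      + 2 * (x + t * h) * q * r > 0"
    unfolding F_def by simp
qed

text \<open>
  Along the direction \<open>(h, k, m)\<close>, the function \<open>gram\<close> has first derivative \<open>2 * P\<close> and second
  derivative \<open>2 * R\<close>, so its square root has second derivative
  \<open>(R * gram - P\<^sup>2) / gram powr (3 / 2)\<close>. The quadratic form \<open>P\<^sup>2 - R * gram\<close> in \<open>(h, k, m)\<close> is, after
  scaling the variables, the one with unit diagonal and off-diagonal entries minus the cosines of
  the angles of the spherical triangle, which is the Gram matrix of the polar triangle. It is
  positive definite, as completing the squares shows directly.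
\<close>

lemma sqrt_gram_Hessian_neg:
  fixes x y z h k m :: real
  assumes E: "elliptope x y z" and nz: "h \<noteq> 0 \<or> k \<noteq> 0 \<or> m \<noteq> 0"
  defines "P \<equiv> (y * z - x) * h + (x * z - y) * k + (x * y - z) * m"
    and "R \<equiv> 2 * (z * h * k + y * h * m + x * k * m) - h\<^sup>2 - k\<^sup>2 - m\<^sup>2"
  shows "R * gram x y z < P\<^sup>2"
proof (rule ccontr)
  assume neg: "\<not> R * gram x y z < P\<^sup>2"
  define G where "G = gram x y z"
  define X Y Z where "X = 1 - x\<^sup>2" and "Y = 1 - y\<^sup>2" and "Z = 1 - z\<^sup>2"
  have pos: "X > 0" "Y > 0" "Z > 0" "G > 0"
    using E by (simp_all add: elliptope_def X_def Y_def Z_def G_def)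
  define L where "L = Y * Z * h + Z * (x * y - z) * k + Y * (x * z - y) * m"
  define M where "M = Z * k - x * Y * m"
  have "Y * Z * (P\<^sup>2 - R * G) = L\<^sup>2 + G * (M\<^sup>2 + X * Y\<^sup>2 * m\<^sup>2)"
    unfolding P_def R_def G_def gram_def L_def M_def X_def Y_def Z_def by algebra
  moreover have "Y * Z * (P\<^sup>2 - R * G) \<le> 0"
    using neg pos by (simp add: G_def mult_le_0_iff)
  ultimately have "L\<^sup>2 + G * (M\<^sup>2 + X * Y\<^sup>2 * m\<^sup>2) \<le> 0" by simp
  moreover have nn: "L\<^sup>2 \<ge> 0" "M\<^sup>2 \<ge> 0" "X * Y\<^sup>2 * m\<^sup>2 \<ge> 0" using pos by simp_all
  moreover have "G * (M\<^sup>2 + X * Y\<^sup>2 * m\<^sup>2) \<ge> 0" using pos nn by simp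
  ultimately have "L\<^sup>2 = 0" "G * (M\<^sup>2 + X * Y\<^sup>2 * m\<^sup>2) = 0" by linarith+
  then have "L = 0" "M\<^sup>2 + X * Y\<^sup>2 * m\<^sup>2 = 0" using pos by simp_all
  then have "L = 0" "M = 0" "m = 0" using nn pos by (simp_all add: add_nonneg_eq_0_iff)
  then show False using nz pos by (auto simp: L_def M_def)
qed

text \<open>The derivative \<open>f\<close> of the square root of \<open>gram\<close> along the segment joining the two points is
  strictly decreasing, by the preceding two lemmas.\<close>

lemma sqrt_gram_gradient_strictly_monotone:
  assumes E: "elliptope x y z" and E': "elliptope x' y' z'"
    and ne: "x' \<noteq> x \<or> y' \<noteq> y \<or> z' \<noteq> z"
  defines "g \<equiv> sqrt (gram x y z)" and "g' \<equiv> sqrt (gram x' y' z')"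
  shows "((x - y * z) / g - (x' - y' * z') / g') * (x - x')
    + ((y - z * x) / g - (y' - z' * x') / g') * (y - y')
    + ((z - x * y) / g - (z' - x' * y') / g') * (z - z') > 0"
proof -
  define h k m where "h = x' - x" and "k = y' - y" and "m = z' - z"
  define X Y Z where "X t = x + t * h" and "Y t = y + t * k" and "Z t = z + t * m" for t
  define G where "G t = gram (X t) (Y t) (Z t)" for t
  define P where "P t = (Y t * Z t - X t) * h + (X t * Z t - Y t) * k + (X t * Y t - Z t) * m" for t
  define R where "R t = 2 * (Z t * h * k + Y t * h * m + X t * k * m) - h\<^sup>2 - k\<^sup>2 - m\<^sup>2" for t
  define f where "f t = P t / sqrt (G t)" for t
  have "f 1 < f 0"
  proof (rule DERIV_neg_imp_decreasing[where f = f and a = 0 and b = 1])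
    fix t :: real assume t: "0 \<le> t" "t \<le> 1"
    have El: "elliptope (X t) (Y t) (Z t)"
      unfolding X_def Y_def Z_def
      using E E' t by (intro elliptope_convex) (simp_all add: h_def k_def m_def)
    then have Gpos: "G t > 0" by (simp add: elliptope_def G_def)
    have dX: "(X has_real_derivative h) (at t)" "(Y has_real_derivative k) (at t)"
      "(Z has_real_derivative m) (at t)"
      unfolding X_def Y_def Z_def by (auto intro!: derivative_eq_intros)
    have dG: "(G has_real_derivative 2 * P t) (at t)"
      unfolding G_def gram_def P_def
      by (rule derivative_eq_intros dX refl)+ (simp add: algebra_simps)
    have dP: "(P has_real_derivative R t) (at t)"
      unfolding P_def R_def
      by (rule derivative_eq_intros dX refl)+ (simp add: algebra_simps power2_eq_square)
    have dS: "((\<lambda>t. sqrt (G t)) has_real_derivative P t / sqrt (G t)) (at t)"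
      using DERIV_chain2[OF DERIV_real_sqrt[OF Gpos] dG] by (simp add: field_simps)
    have "(f has_real_derivative (R t * G t - (P t)\<^sup>2) / (G t * sqrt (G t))) (at t)"
      unfolding f_def
      by (rule derivative_eq_intros dP dS refl)+ (use Gpos in \<open>simp_all add: field_simps power2_eq_square\<close>)
    moreover have "R t * G t < (P t)\<^sup>2"
      using sqrt_gram_Hessian_neg[OF El, of h k m] ne
      by (auto simp: R_def G_def P_def h_def k_def m_def)
    then have "(R t * G t - (P t)\<^sup>2) / (G t * sqrt (G t)) < 0"
      using Gpos by (simp add: divide_neg_pos)
    ultimately show "\<exists>d. (f has_real_derivative d) (at t) \<and> d < 0" by blast
  qed simp
  moreover have "f 0 = ((y * z - x) * h + (x * z - y) * k + (x * y - z) * m) / g"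
    by (simp add: f_def P_def G_def X_def Y_def Z_def g_def)
  moreover have "f 1 = ((y' * z' - x') * h + (x' * z' - y') * k + (x' * y' - z') * m) / g'"
    by (simp add: f_def P_def G_def X_def Y_def Z_def g'_def h_def k_def m_def)
  ultimately show ?thesis
    by (simp add: h_def k_def m_def add_divide_distrib diff_divide_distrib algebra_simps)
qed

text \<open>The determinant factors as
  \<open>(cos (b - c) - cos a) * (cos a - cos (b + c))\<close>. The triangle inequalities say that \<open>a\<close> lies
  between \<open>\<bar>b - c\<bar>\<close> and \<open>b + c\<close>, and the perimeter bound that it is less than
  \<open>2 * pi - (b + c)\<close>, which is what is needed when \<open>b + c\<close> exceeds \<open>pi\<close>.\<close>

lemma elliptope_cos:
  assumes pos: "a > 0" "b > 0" "c > 0" and tri: "a + b > c" "b + c > a" "c + a > b"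
    and per: "a + b + c < 2 * pi"
  shows "elliptope (cos a) (cos b) (cos c)"
proof -
  have lt: "a < pi" "b < pi" "c < pi" using tri per by linarith+
  have sq: "(cos x)\<^sup>2 < 1" if "0 < x" "x < pi" for x
    using sin_gt_zero[OF that] sin_squared_eq[of x] by (smt (verit) zero_less_power)
  have "gram (cos a) (cos b) (cos c) = (sin b)\<^sup>2 * (sin c)\<^sup>2 - (cos a - cos b * cos c)\<^sup>2"
    unfolding gram_def sin_squared_eq by algebra
  also have "\<dots> = (cos (b - c) - cos a) * (cos a - cos (b + c))"
    unfolding cos_add cos_diff by algebra
  also have "\<dots> > 0"
  proof (rule mult_pos_pos)
    have "cos a < cos \<bar>b - c\<bar>" using lt tri by (intro cos_monotone_0_pi) auto
    then show "cos (b - c) - cos a > 0" by simp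
    show "cos a - cos (b + c) > 0"
    proof (cases "b + c \<le> pi")
      case True
      then show ?thesis using cos_monotone_0_pi[of a "b + c"] pos tri by simp
    next
      case False
      then have "cos (2 * pi - (b + c)) < cos a" using pos per by (intro cos_monotone_0_pi) auto
      then show ?thesis by (simp add: cos_diff)
    qed
  qed
  finally show ?thesis using sq pos lt by (simp add: elliptope_def)
qed

lemma norm_sphere_direction:
  assumes "P \<in> sphere 0 1" "Q \<in> sphere 0 1" "0 < d" "d < pi" "P \<bullet> Q = cos d"
  shows "norm (sphere_direction P Q) = sin d"
proof -
  have "P \<bullet> P = 1" "Q \<bullet> Q = 1" using assms(1,2) by (simp_all add: dot_square_norm)
  moreover have "(norm (sphere_direction P Q))\<^sup>2 = Q \<bullet> Q - 2 * (P \<bullet> Q)\<^sup>2 + (P \<bullet> Q)\<^sup>2 * (P \<bullet> P)"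
    unfolding power2_norm_eq_inner sphere_direction_def
    by (simp add: inner_diff inner_commute power2_eq_square algebra_simps)
  ultimately have "(norm (sphere_direction P Q))\<^sup>2 = (sin d)\<^sup>2"
    using assms(5) by (simp add: sin_squared_eq)
  then show ?thesis using sin_gt_zero[OF assms(3,4)] by (simp add: power2_eq_iff_nonneg)
qed

lemma vec_angle_sphere_direction:
  assumes "A \<in> sphere 0 1" "B \<in> sphere 0 1" "C \<in> sphere 0 1"
    and "0 < b" "b < pi" "0 < c" "c < pi"
    and "B \<bullet> C = cos a" "A \<bullet> C = cos b" "A \<bullet> B = cos c"
  shows "vec_angle (sphere_direction A B) (sphere_direction A C)
    = arccos ((cos a - cos b * cos c) / (sin b * sin c))"
proof -
  have "A \<bullet> A = 1" using assms(1) by (simp add: dot_square_norm)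
  then have "sphere_direction A B \<bullet> sphere_direction A C = cos a - cos b * cos c"
    using assms(8-10) unfolding sphere_direction_def by (simp add: inner_diff inner_commute)
  then show ?thesis
    using norm_sphere_direction[of A B c] norm_sphere_direction[of A C b] assms
    by (simp add: vec_angle_def mult.commute)
qed

text \<open>As in the plane, the spherical law of cosines determines the angle, and an explicit triangle
  with one corner at the first basis vector shows existence.\<close>

lemma cot_spherical_angle:
  assumes pos: "a > 0" "b > 0" "c > 0" and tri: "a + b > c" "b + c > a" "c + a > b"
    and per: "a + b + c < 2 * pi"
  shows "cot (spherical_angle a b c)
    = (cos a - cos b * cos c) / sqrt (gram (cos a) (cos b) (cos c))"
proof -
  have lt: "a < pi" "b < pi" "c < pi" using tri per by linarith+
  have s: "sin b > 0" "sin c > 0" using sin_gt_zero pos lt by auto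
  define x where "x = (cos a - cos b * cos c) / (sin b * sin c)"
  have G: "gram (cos a) (cos b) (cos c) > 0" using elliptope_cos[OF assms] by (simp add: elliptope_def)
  have gram: "gram (cos a) (cos b) (cos c) = (sin b * sin c)\<^sup>2 - (cos a - cos b * cos c)\<^sup>2"
    unfolding gram_def power_mult_distrib sin_squared_eq by algebra
  note q = cot_arccos_quotient[OF _ G gram]
  have x1: "\<bar>x\<bar> < 1" unfolding x_def using q(1) s by simp
  have "spherical_angle a b c = arccos x"
    unfolding spherical_angle_def
  proof (rule the_equality)
    define A B C :: "real ^ 3" where "A = vector [1, 0, 0]" and "B = vector [cos c, sin c, 0]"
      and "C = vector [cos b, sin b * x, sin b * sqrt (1 - x\<^sup>2)]"
    have sq: "(sqrt (1 - x\<^sup>2))\<^sup>2 = 1 - x\<^sup>2" using x1 by (simp add: abs_square_le_1 less_imp_le)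
    have "A \<bullet> A = 1" "B \<bullet> B = 1"
      by (simp_all add: A_def B_def inner_vec_def sum_3 power2_eq_square[symmetric])
    moreover have "C \<bullet> C = (cos b)\<^sup>2 + (sin b)\<^sup>2 * (x\<^sup>2 + (sqrt (1 - x\<^sup>2))\<^sup>2)"
      by (simp add: C_def inner_vec_def sum_3 power2_eq_square algebra_simps del: real_sqrt_mult_self)
    then have "C \<bullet> C = 1" unfolding sq by simp
    ultimately have S: "A \<in> sphere 0 1" "B \<in> sphere 0 1" "C \<in> sphere 0 1"
      by (simp_all add: norm_eq_1)
    have AB: "A \<bullet> B = cos c" and AC: "A \<bullet> C = cos b"
      by (simp_all add: A_def B_def C_def inner_vec_def sum_3)
    have "B \<bullet> C = cos b * cos c + sin b * sin c * x"
      by (simp add: B_def C_def inner_vec_def sum_3)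
    then have BC: "B \<bullet> C = cos a" using s by (simp add: x_def)
    have "sphere_dist B C = a" "sphere_dist C A = b" "sphere_dist A B = c"
      using AB AC BC pos lt by (simp_all add: sphere_dist_def inner_commute arccos_cos)
    moreover have "arccos x = vec_angle (sphere_direction A B) (sphere_direction A C)"
      unfolding x_def using vec_angle_sphere_direction[OF S] pos lt AB AC BC by simp
    ultimately show "\<exists>A\<in>sphere 0 1. \<exists>B\<in>sphere 0 1. \<exists>C\<in>sphere 0 1.
        sphere_dist B C = a \<and> sphere_dist C A = b \<and> sphere_dist A B = c \<and>
        arccos x = vec_angle (sphere_direction A B) (sphere_direction A C)" using S by blast
  next
    fix \<theta> assume "\<exists>A\<in>sphere 0 1. \<exists>B\<in>sphere 0 1. \<exists>C\<in>sphere 0 1.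
        sphere_dist B C = a \<and> sphere_dist C A = b \<and> sphere_dist A B = c \<and>
        \<theta> = vec_angle (sphere_direction A B) (sphere_direction A C)"
    then obtain A B C :: "real ^ 3" where S: "A \<in> sphere 0 1" "B \<in> sphere 0 1" "C \<in> sphere 0 1"
      and d: "sphere_dist B C = a" "sphere_dist C A = b" "sphere_dist A B = c"
      and \<theta>: "\<theta> = vec_angle (sphere_direction A B) (sphere_direction A C)" by blast
    have dot: "P \<bullet> Q = cos (sphere_dist P Q)" if "P \<in> sphere 0 1" "Q \<in> sphere 0 1" for P Q
      using Cauchy_Schwarz_ineq2[of P Q] that by (simp add: sphere_dist_def cos_arccos_abs)
    have "B \<bullet> C = cos a" "A \<bullet> C = cos b" "A \<bullet> B = cos c"
      using dot[of B C] dot[of C A] dot[of A B] S d by (simp_all add: inner_commute)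
    then show "\<theta> = arccos x"
      unfolding \<theta> x_def using vec_angle_sphere_direction[OF S] pos lt by simp
  qed
  then show ?thesis unfolding x_def using q(2) s by simp
qed

text \<open>Strict monotonicity transferred to side lengths; the sides lie in the interval from \<open>0\<close> to
  \<open>pi\<close>, where the cosine is injective.\<close>

lemma spherical_triangle_rigid:
  assumes pos: "a > 0" "b > 0" "c > 0" and tri: "a + b > c" "b + c > a" "c + a > b"
    and per: "a + b + c < 2 * pi"
    and pos': "a' > 0" "b' > 0" "c' > 0" and tri': "a' + b' > c'" "b' + c' > a'" "c' + a' > b'"
    and per': "a' + b' + c' < 2 * pi"
  defines "D \<equiv> (cot (spherical_angle a b c) - cot (spherical_angle a' b' c')) * (cos a - cos a')
    + (cot (spherical_angle b c a) - cot (spherical_angle b' c' a')) * (cos b - cos b')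
    + (cot (spherical_angle c a b) - cot (spherical_angle c' a' b')) * (cos c - cos c')"
  shows "D \<ge> 0" and "D = 0 \<Longrightarrow> a = a' \<and> b = b' \<and> c = c'"
proof -
  define g g' where "g = gram (cos a) (cos b) (cos c)" and "g' = gram (cos a') (cos b') (cos c')"
  have rot: "gram (cos b) (cos c) (cos a) = g" "gram (cos c) (cos a) (cos b) = g"
    "gram (cos b') (cos c') (cos a') = g'" "gram (cos c') (cos a') (cos b') = g'"
    by (simp_all add: g_def g'_def gram_def algebra_simps)
  have cots: "cot (spherical_angle a b c) = (cos a - cos b * cos c) / sqrt g"
    "cot (spherical_angle b c a) = (cos b - cos c * cos a) / sqrt g"
    "cot (spherical_angle c a b) = (cos c - cos a * cos b) / sqrt g"
    "cot (spherical_angle a' b' c') = (cos a' - cos b' * cos c') / sqrt g'"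
    "cot (spherical_angle b' c' a') = (cos b' - cos c' * cos a') / sqrt g'"
    "cot (spherical_angle c' a' b') = (cos c' - cos a' * cos b') / sqrt g'"
    using cot_spherical_angle pos tri per pos' tri' per' rot g_def g'_def by simp_all
  have lt: "a < pi" "b < pi" "c < pi" "a' < pi" "b' < pi" "c' < pi"
    using tri per tri' per' by linarith+
  have strict: "D > 0" if "\<not> (a = a' \<and> b = b' \<and> c = c')"
  proof -
    have "cos a' \<noteq> cos a \<or> cos b' \<noteq> cos b \<or> cos c' \<noteq> cos c"
      using that pos pos' lt by (metis arccos_cos less_imp_le)
    then show ?thesis
      unfolding D_def cots g_def g'_def
      by (intro sqrt_gram_gradient_strictly_monotone elliptope_cos assms)
  qed
  have "D = 0" if "a = a' \<and> b = b' \<and> c = c'" using that by (simp add: D_def)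
  then show "D \<ge> 0" using strict by fastforce
  show "D = 0 \<Longrightarrow> a = a' \<and> b = b' \<and> c = c'" using strict by fastforce
qed

section \<open>Rigidity of polyhedral surfaces\<close>

lemma sum_angle_facing:
  fixes y :: "('f \<times> 3) set \<Rightarrow> real"
  shows "(\<Sum>i\<in>UNIV. (cot (angle_facing ang S l (t, i)) - cot (angle_facing ang S l' (t, i)))
      * y (edge_at S (t, i)))
    = (let L = (\<lambda>i. l (edge_at S (t, i))); L' = (\<lambda>i. l' (edge_at S (t, i))) in
       (cot (ang (L 0) (L 1) (L 2)) - cot (ang (L' 0) (L' 1) (L' 2))) * y (edge_at S (t, 0))
     + (cot (ang (L 1) (L 2) (L 0)) - cot (ang (L' 1) (L' 2) (L' 0))) * y (edge_at S (t, 1))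
     + (cot (ang (L 2) (L 0) (L 1)) - cot (ang (L' 2) (L' 0) (L' 1))) * y (edge_at S (t, 2)))"
  by (simp add: sum_corners angle_facing_def Let_def numerals_mod_3)

lemma triangle_ineqs:
  fixes L :: "3 \<Rightarrow> real"
  assumes "\<And>i. L i + L (i + 1) > L (i + 2)"
  shows "L 0 + L 1 > L 2" "L 1 + L 2 > L 0" "L 2 + L 0 > L 1"
  using assms[of 0] assms[of 1] assms[of 2] by (simp_all add: numerals_mod_3)

theorem euclidean_polyhedral_surface_rigid:
  assumes S: "closed_triangulated_surface S" and conn: "connected_surface S"
    and l: "euclidean_polyhedral_metric S l" and l': "euclidean_polyhedral_metric S l'"
    and eq: "\<And>e. e \<in> edges S \<Longrightarrow>
      discrete_laplacian euclidean_angle S l e = discrete_laplacian euclidean_angle S l' e"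
  shows "\<exists>c>0. \<forall>e\<in>edges S. l' e = c * l e"
proof -
  have pos: "l (edge_at S (t, i)) > 0" "l' (edge_at S (t, i)) > 0" if "t \<in> triangles S" for t i
    using l l' edge_at_in_edges[OF that] by (auto simp: euclidean_polyhedral_metric_def)
  have tri: "l (edge_at S (t, i)) + l (edge_at S (t, i + 1)) > l (edge_at S (t, i + 2))"
    "l' (edge_at S (t, i)) + l' (edge_at S (t, i + 1)) > l' (edge_at S (t, i + 2))"
    if "t \<in> triangles S" for t i
    using l l' that by (auto simp: euclidean_polyhedral_metric_def)
  define D where
    "D s = cot (angle_facing euclidean_angle S l s) - cot (angle_facing euclidean_angle S l' s)" for s
  have bal: "(\<Sum>s\<in>e. D s) = 0" if "e \<in> edges S" for e
    unfolding D_def using same_laplacian_imp_balanced_cot[OF eq[OF that]] .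
  have rigid: "(\<Sum>i\<in>UNIV. D (t, i) * (l' (edge_at S (t, i)))\<^sup>2) \<ge> 0"
    "(\<Sum>i\<in>UNIV. D (t, i) * (l' (edge_at S (t, i)))\<^sup>2) = 0 \<Longrightarrow>
      \<exists>k>0. \<forall>i. l' (edge_at S (t, i)) = k * l (edge_at S (t, i))" if t: "t \<in> triangles S" for t
  proof -
    define L L' where "L i = l (edge_at S (t, i))" and "L' i = l' (edge_at S (t, i))" for i
    have "L i > 0" "L' i > 0" "L i + L (i + 1) > L (i + 2)" "L' i + L' (i + 1) > L' (i + 2)" for i
      using pos[OF t] tri[OF t] by (simp_all add: L_def L'_def)
    note R = euclidean_triangle_rigid[OF this(1,1,1) triangle_ineqs[of L, OF this(3)]
        this(2,2,2) triangle_ineqs[of L', OF this(4)]]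
    note sum = sum_angle_facing[of euclidean_angle S l t l' "\<lambda>e. (l' e)\<^sup>2",
        folded D_def L_def L'_def, unfolded Let_def]
    show "(\<Sum>i\<in>UNIV. D (t, i) * (l' (edge_at S (t, i)))\<^sup>2) \<ge> 0"
      using R(1) sum by (simp add: L_def L'_def)
    assume "(\<Sum>i\<in>UNIV. D (t, i) * (l' (edge_at S (t, i)))\<^sup>2) = 0"
    then show "\<exists>k>0. \<forall>i. l' (edge_at S (t, i)) = k * l (edge_at S (t, i))"
      using R(2) sum by (simp add: L_def L'_def all_corners)
  qed
  have "\<exists>k>0. \<forall>i. l' (edge_at S (t, i)) = k * l (edge_at S (t, i))" if "t \<in> triangles S" for t
    using rigid(2)[OF that]
      triangle_terms_zero_if_edgewise_balanced[OF S bal, of "\<lambda>e. (l' e)\<^sup>2", OF _ rigid(1) that] by simp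
  \<comment> \<open>The scaling factor of each triangle.\<close>
  then obtain k where k: "k t > 0" "l' (edge_at S (t, i)) = k t * l (edge_at S (t, i))"
    if "t \<in> triangles S" for t i by metis
  have step: "t' \<in> triangles S \<and> k t' = k t" if adj: "(t, t') \<in> adjacent S" for t t'
  proof -
    obtain i where t: "t \<in> triangles S" and i: "t' = fst (glue S (t, i))"
      using adj by (auto simp: adjacent_def)
    define j where "j = snd (glue S (t, i))"
    have g: "glue S (t, i) = (t', j)" by (simp add: i j_def)
    have "(t, i) \<in> sides S" using t by (simp add: sides_def)
    then have "(t', j) \<in> sides S" and g': "glue S (t', j) = (t, i)"
      using S g by (force simp: closed_triangulated_surface_def)+
    then have t': "t' \<in> triangles S" by (simp add: sides_def)
    have "edge_at S (t', j) = edge_at S (t, i)" using g g' by (auto simp: edge_at_def)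
    then have "k t' * l (edge_at S (t, i)) = k t * l (edge_at S (t, i))"
      using k(2)[OF t, of i] k(2)[OF t', of j] by metis
    then show ?thesis using t' pos(1)[OF t, of i] by simp
  qed
  show ?thesis
  proof (cases "triangles S = {}")
    case True
    then show ?thesis by (intro exI[of _ 1]) (auto simp: edges_def sides_def)
  next
    case False
    then obtain t\<^sub>0 where t\<^sub>0: "t\<^sub>0 \<in> triangles S" by blast
    have "k t = k t\<^sub>0" if "t \<in> triangles S" for t
    proof -
      have "(t\<^sub>0, t) \<in> (adjacent S)\<^sup>*" using conn t\<^sub>0 that by (auto simp: connected_surface_def)
      then show ?thesis by (induction rule: rtrancl_induct) (use step in auto)
    qed
    then have "\<forall>e\<in>edges S. l' e = k t\<^sub>0 * l e" using k(2) by (metis edges_E)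
    then show ?thesis using k(1)[OF t\<^sub>0] by blast
  qed
qed

theorem spherical_polyhedral_surface_rigid:
  assumes S: "closed_triangulated_surface S"
    and l: "spherical_polyhedral_metric S l" and l': "spherical_polyhedral_metric S l'"
    and eq: "\<And>e. e \<in> edges S \<Longrightarrow>
      discrete_laplacian spherical_angle S l e = discrete_laplacian spherical_angle S l' e"
    and e: "e \<in> edges S"
  shows "l e = l' e"
proof -
  have pos: "l (edge_at S (t, i)) > 0" "l' (edge_at S (t, i)) > 0" if "t \<in> triangles S" for t i
    using l l' edge_at_in_edges[OF that] by (auto simp: spherical_polyhedral_metric_def)
  have tri: "l (edge_at S (t, i)) + l (edge_at S (t, i + 1)) > l (edge_at S (t, i + 2))"
    "l' (edge_at S (t, i)) + l' (edge_at S (t, i + 1)) > l' (edge_at S (t, i + 2))"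
    if "t \<in> triangles S" for t i
    using l l' that by (auto simp: spherical_polyhedral_metric_def)
  have per: "l (edge_at S (t, 0)) + l (edge_at S (t, 1)) + l (edge_at S (t, 2)) < 2 * pi"
    "l' (edge_at S (t, 0)) + l' (edge_at S (t, 1)) + l' (edge_at S (t, 2)) < 2 * pi"
    if "t \<in> triangles S" for t
    using l l' that by (auto simp: spherical_polyhedral_metric_def)
  define D where
    "D s = cot (angle_facing spherical_angle S l s) - cot (angle_facing spherical_angle S l' s)" for s
  define y where "y e = cos (l e) - cos (l' e)" for e
  have bal: "(\<Sum>s\<in>e. D s) = 0" if "e \<in> edges S" for e
    unfolding D_def using same_laplacian_imp_balanced_cot[OF eq[OF that]] .
  have rigid: "(\<Sum>i\<in>UNIV. D (t, i) * y (edge_at S (t, i))) \<ge> 0"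
    "(\<Sum>i\<in>UNIV. D (t, i) * y (edge_at S (t, i))) = 0 \<Longrightarrow>
      \<forall>i. l (edge_at S (t, i)) = l' (edge_at S (t, i))" if t: "t \<in> triangles S" for t
  proof -
    define L L' where "L i = l (edge_at S (t, i))" and "L' i = l' (edge_at S (t, i))" for i
    have facts: "L i > 0" "L' i > 0" "L i + L (i + 1) > L (i + 2)" "L' i + L' (i + 1) > L' (i + 2)" for i
      using pos[OF t] tri[OF t] by (simp_all add: L_def L'_def)
    have "L 0 + L 1 + L 2 < 2 * pi" "L' 0 + L' 1 + L' 2 < 2 * pi"
      using per[OF t] by (simp_all add: L_def L'_def)
    note R = spherical_triangle_rigid[OF facts(1,1,1) triangle_ineqs[of L, OF facts(3)] this(1)
        facts(2,2,2) triangle_ineqs[of L', OF facts(4)] this(2)]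
    note sum = sum_angle_facing[of spherical_angle S l t l' y,
        folded D_def L_def L'_def, unfolded Let_def]
    show "(\<Sum>i\<in>UNIV. D (t, i) * y (edge_at S (t, i))) \<ge> 0"
      using R(1) sum by (simp add: L_def L'_def y_def)
    assume "(\<Sum>i\<in>UNIV. D (t, i) * y (edge_at S (t, i))) = 0"
    then show "\<forall>i. l (edge_at S (t, i)) = l' (edge_at S (t, i))"
      using R(2) sum by (simp add: L_def L'_def y_def all_corners)
  qed
  obtain t i where t: "t \<in> triangles S" and ti: "e = edge_at S (t, i)" using e by (rule edges_E)
  have "(\<Sum>i\<in>UNIV. D (t, i) * y (edge_at S (t, i))) = 0"
    by (rule triangle_terms_zero_if_edgewise_balanced[OF S bal rigid(1) t])
  then show ?thesis using rigid(2)[OF t] ti by blast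
qed

theorem corollary1p3:
  "(\<forall>(S :: 'f triangulated_surface) l l'.
      closed_triangulated_surface S \<and> connected_surface S \<and>
      euclidean_polyhedral_metric S l \<and> euclidean_polyhedral_metric S l' \<and>
      (\<forall>e\<in>edges S. discrete_laplacian euclidean_angle S l e
                   = discrete_laplacian euclidean_angle S l' e)
      \<longrightarrow> (\<exists>c>0. \<forall>e\<in>edges S. l' e = c * l e)) \<and>
   (\<forall>(S :: 'f triangulated_surface) l l'.
      closed_triangulated_surface S \<and>
      spherical_polyhedral_metric S l \<and> spherical_polyhedral_metric S l' \<and>
      (\<forall>e\<in>edges S. discrete_laplacian spherical_angle S l e
                   = discrete_laplacian spherical_angle S l' e)
      \<longrightarrow> (\<forall>e\<in>edges S. l e = l' e))"
proof (intro conjI allI impI ballI)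
  fix S :: "'f triangulated_surface" and l l' :: "('f \<times> 3) set \<Rightarrow> real"
  assume "closed_triangulated_surface S \<and> connected_surface S \<and>
    euclidean_polyhedral_metric S l \<and> euclidean_polyhedral_metric S l' \<and>
    (\<forall>e\<in>edges S. discrete_laplacian euclidean_angle S l e
       = discrete_laplacian euclidean_angle S l' e)"
  then show "\<exists>c>0. \<forall>e\<in>edges S. l' e = c * l e"
    by (elim conjE) (rule euclidean_polyhedral_surface_rigid, simp_all)
next
  fix S :: "'f triangulated_surface" and l l' :: "('f \<times> 3) set \<Rightarrow> real" and e
  assume "closed_triangulated_surface S \<and>
    spherical_polyhedral_metric S l \<and> spherical_polyhedral_metric S l' \<and>
    (\<forall>e\<in>edges S. discrete_laplacian spherical_angle S l e
       = discrete_laplacian spherical_angle S l' e)" and "e \<in> edges S"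
  then show "l e = l' e"
    by (elim conjE) (rule spherical_polyhedral_surface_rigid, simp_all)
qed

end
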